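(* Let $\alpha,\beta$ be positive real numbers satisfying $\alpha(e-1)+\beta e\ge e$, and let $p\in\mathcal{H}_1$. If $$(1-\alpha)p(z)+\alpha p^2(z)+\beta zp'(z)\prec 1+z,$$ then $p(z)\prec e^z$.
   Context: $\mathbb{D}=\{z\in\mathbb{C}:|z|<1\}$. $\mathcal{H}_1$ is the class of analytic functions on $\mathbb{D}$ of the form $p(z)=1+a_1z+a_2z^2+\cdots$. $p^2(z)$ means $(p(z))^2$. For functions $F,G$ analytic in $\mathbb{D}$, $F\prec G$ (F is subordinate to G) means there is an analytic $w:\mathbb{D}\to\mathbb{C}$ with $w(0)=0$, $|w(z)|<1$ and $F(z)=G(w(z))$ for all $z\in\mathbb{D}$. *)

theory Defs
  imports "HOL-Complex_Analysis.Complex_Analysis"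
begin

text \<open>
  The open unit disc is \<^term>\<open>ball (0::complex) 1\<close>. Functions on the disc are total functions on
  \<^typ>\<open>complex\<close>, whose values outside the disc are irrelevant. On this open set, being holomorphic
  and being analytic coincide (\<open>analytic_on_open\<close>).
\<close>

text \<open>The normalisation \<open>p(z) = 1 + a\<^sub>1 z + a\<^sub>2 z\<^sup>2 + \<dots>\<close> prescribes exactly the
  constant term of the Taylor expansion at \<open>0\<close>.\<close>

definition class_H1 :: "(complex \<Rightarrow> complex) set" where
  "class_H1 = {p. p holomorphic_on ball 0 1 \<and> p 0 = 1}"

definition subordinate :: "(complex \<Rightarrow> complex) \<Rightarrow> (complex \<Rightarrow> complex) \<Rightarrow> bool"
    (infix "\<prec>\<^sub>s" 50) where
  "F \<prec>\<^sub>s G \<longleftrightarrow> F holomorphic_on ball 0 1 \<and> G holomorphic_on ball 0 1 \<and>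
     (\<exists>w. w holomorphic_on ball 0 1 \<and> w 0 = 0 \<and>
       (\<forall>z\<in>ball 0 1. norm (w z) < 1 \<and> F z = G (w z)))"

end

theory Submission
  imports Defs
begin

text \<open>
  If \<open>p\<close> leaves \<open>exp (ball 0 1)\<close>, take an exit point \<open>z\<^sub>0\<close> of least modulus and put
  \<open>\<zeta> = Ln (p z\<^sub>0)\<close>, so that \<open>norm \<zeta> = 1\<close>. Jack's lemma for \<open>Ln \<circ> p\<close> gives
  \<open>z\<^sub>0 p'(z\<^sub>0) = m \<zeta> e\<^sup>\<zeta>\<close> with \<open>m \<ge> 1\<close>, so the left-hand side of the subordination at \<open>z\<^sub>0\<close> is
  \<open>A = e\<^sup>\<zeta> (1 - \<alpha> + \<alpha> e\<^sup>\<zeta> + k \<zeta>)\<close> with \<open>k = \<beta> m\<close> and \<open>\<alpha> (1 - 1/e) + k \<ge> 1\<close>. This forces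
  \<open>norm (A - 1) \<ge> 1\<close>, a contradiction: if \<open>Re \<zeta> \<le> 0\<close> then \<open>Re A \<le> 0\<close>, and if
  \<open>Re \<zeta> \<ge> 0\<close> then \<open>(A - 1) e\<^bsup>-\<zeta>\<^esup>\<close> has a large component in the direction of \<open>\<zeta>\<close>.
\<close>

section \<open>Polynomial bounds for sine and cosine near the origin\<close>

lemma cos_ge_quadratic: "1 - x\<^sup>2 / 2 \<le> cos (x::real)"
proof -
  have "(sin (x/2))\<^sup>2 \<le> (x/2)\<^sup>2"
    using abs_sin_x_le_abs_x[of "x/2"] by (simp only: abs_le_square_iff)
  moreover have "cos x = 1 - 2 * (sin (x/2))\<^sup>2"
    using cos_double_sin[of "x/2"] by simp
  ultimately show ?thesis by (simp add: power_divide)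
qed

lemma sin_ge_cubic:
  fixes x :: real
  assumes "0 \<le> x"
  shows "x - x ^ 3 / 6 \<le> sin x"
proof -
  have "sin 0 - 0 + 0 ^ 3 / 6 \<le> sin x - x + x ^ 3 / 6"
  proof (rule DERIV_nonneg_imp_nondecreasing[OF assms])
    fix t :: real
    have "((\<lambda>x. sin x - x + x ^ 3 / 6) has_real_derivative cos t - 1 + t\<^sup>2 / 2) (at t)"
      by (auto intro!: derivative_eq_intros simp: power2_eq_square)
    then show "\<exists>y. ((\<lambda>x. sin x - x + x ^ 3 / 6) has_real_derivative y) (at t) \<and> 0 \<le> y"
      using cos_ge_quadratic[of t] by force
  qed
  then show ?thesis by simp
qed

lemma x_cos_le_sin:
  fixes x :: real
  assumes "0 \<le> x" "x \<le> pi"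
  shows "x * cos x \<le> sin x"
proof -
  have "sin 0 - 0 * cos 0 \<le> sin x - x * cos x"
  proof (rule DERIV_nonneg_imp_nondecreasing[OF assms(1)])
    fix t :: real
    assume "0 \<le> t" "t \<le> x"
    then have "0 \<le> t * sin t"
      using assms by (intro mult_nonneg_nonneg sin_ge_zero) auto
    moreover have "((\<lambda>x. sin x - x * cos x) has_real_derivative t * sin t) (at t)"
      by (auto intro!: derivative_eq_intros)
    ultimately show "\<exists>y. ((\<lambda>x. sin x - x * cos x) has_real_derivative y) (at t) \<and> 0 \<le> y"
      by blast
  qed
  then show ?thesis by simp
qed

text \<open>All expressions are even in \<open>x\<close>, so the bounds for nonnegative arguments
  apply to \<open>\<bar>x\<bar>\<close>.\<close>

lemma x_sin_ge:
  fixes x :: real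
  assumes "\<bar>x\<bar> \<le> 1"
  shows "x\<^sup>2 - x ^ 4 / 6 \<le> x * sin x" and "x\<^sup>2 * cos x \<le> x * sin x" and "0 \<le> x * sin x"
proof -
  have eq: "x * sin x = \<bar>x\<bar> * sin \<bar>x\<bar>" "cos x = cos \<bar>x\<bar>"
    by (auto simp: abs_if)
  have "\<bar>x\<bar> * (\<bar>x\<bar> - \<bar>x\<bar> ^ 3 / 6) \<le> \<bar>x\<bar> * sin \<bar>x\<bar>"
    by (intro mult_left_mono sin_ge_cubic) auto
  moreover have "\<bar>x\<bar> * (\<bar>x\<bar> - \<bar>x\<bar> ^ 3 / 6) = x\<^sup>2 - x ^ 4 / 6"
    by (simp add: abs_if power2_eq_square power3_eq_cube power4_eq_xxxx algebra_simps)
  ultimately show "x\<^sup>2 - x ^ 4 / 6 \<le> x * sin x" by (simp add: eq)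
  have "\<bar>x\<bar> * (\<bar>x\<bar> * cos \<bar>x\<bar>) \<le> \<bar>x\<bar> * sin \<bar>x\<bar>"
    using assms pi_gt3 by (intro mult_left_mono x_cos_le_sin) auto
  then show "x\<^sup>2 * cos x \<le> x * sin x"
    by (simp add: eq(1)) (simp add: abs_if power2_eq_square split: if_splits)
  show "0 \<le> x * sin x"
    unfolding eq using assms pi_gt3 by (intro mult_nonneg_nonneg sin_ge_zero) auto
qed

text \<open>Both sides are compared with polynomials in \<open>x\<^sup>2\<close>, through
  \<open>cos (2 * x) = 1 - 2 * (sin x)\<^sup>2\<close>. The factor \<open>1 - x\<^sup>2\<close> is
  one that can later be dominated by an exponential.\<close>

lemma cos_double_le:
  fixes x :: real
  assumes "\<bar>x\<bar> \<le> 1"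
  shows "cos (2 * x) \<le> (1 - x\<^sup>2) * cos x"
proof -
  have x2: "0 \<le> x\<^sup>2" "x\<^sup>2 \<le> 1"
    using assms by (auto simp: abs_square_le_1)
  \<comment> \<open>The cubic lower bound for sine must be nonnegative before it can be
    squared.\<close>
  have pos: "0 \<le> \<bar>x\<bar> - \<bar>x\<bar> ^ 3 / 6"
    using x2 mult_left_mono[of "x\<^sup>2" 1 "\<bar>x\<bar>"] assms
    by (simp add: power3_eq_cube power2_eq_square mult.assoc)
  have "(\<bar>x\<bar> - \<bar>x\<bar> ^ 3 / 6)\<^sup>2 \<le> (sin \<bar>x\<bar>)\<^sup>2"
    by (rule power_mono[OF sin_ge_cubic pos]) auto
  also have "(sin \<bar>x\<bar>)\<^sup>2 = (sin x)\<^sup>2" by (auto simp: abs_if)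
  also have "(\<bar>x\<bar> - \<bar>x\<bar> ^ 3 / 6)\<^sup>2 = x\<^sup>2 - x\<^sup>2 * x\<^sup>2 / 3 + x ^ 6 / 36"
    by (auto simp: abs_if field_simps power2_eq_square eval_nat_numeral)
  finally have "x\<^sup>2 - x\<^sup>2 * x\<^sup>2 / 3 \<le> (sin x)\<^sup>2"
    using zero_le_even_power[of 6 x, OF even_numeral] by linarith
  then have "cos (2 * x) \<le> 1 - 2 * x\<^sup>2 + 2 / 3 * (x\<^sup>2 * x\<^sup>2)"
    by (simp add: cos_double_sin)
  also have "\<dots> \<le> (1 - x\<^sup>2) * (1 - x\<^sup>2 / 2)"
  proof -
    have "(1 - x\<^sup>2) * (1 - x\<^sup>2 / 2) - (1 - 2 * x\<^sup>2 + 2 / 3 * (x\<^sup>2 * x\<^sup>2))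
        = x\<^sup>2 * (3 - x\<^sup>2) / 6"
      by (simp add: field_simps)
    also have "\<dots> \<ge> 0" using x2 by simp
    finally show ?thesis by simp
  qed
  also have "\<dots> \<le> (1 - x\<^sup>2) * cos x"
    using x2 cos_ge_quadratic by (intro mult_left_mono) auto
  finally show ?thesis .
qed

section \<open>Estimates on the unit circle\<close>

lemma sum_squares_eq_1_imp_abs_le:
  fixes c s :: real
  assumes "c\<^sup>2 + s\<^sup>2 = 1"
  shows "\<bar>c\<bar> \<le> 1" and "\<bar>s\<bar> \<le> 1"
proof -
  have "c\<^sup>2 \<le> 1" "s\<^sup>2 \<le> 1"
    using assms zero_le_power2[of c] zero_le_power2[of s] by linarith+
  then show "\<bar>c\<bar> \<le> 1" "\<bar>s\<bar> \<le> 1"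
    by (simp_all add: abs_square_le_1)
qed

text \<open>For \<open>\<zeta> = c + i s\<close> the left side is \<open>exp (-c) * Re A\<close>.
  The coefficients of \<open>\<alpha>\<close> and \<open>k\<close> are at most
  \<open>- (1 - exp (-1)) * cos s\<close> and \<open>- cos s\<close>, so \<open>bd\<close> outweighs
  the leading \<open>cos s\<close>.\<close>

lemma unit_circle_bound_left:
  fixes c s \<alpha> k :: real
  assumes cs: "c\<^sup>2 + s\<^sup>2 = 1" and "c \<le> 0"
    and "0 \<le> \<alpha>" "0 \<le> k" and bd: "\<alpha> * (1 - exp (-1)) + k \<ge> 1"
  shows "cos s + \<alpha> * (exp c * cos (2 * s) - cos s) + k * (c * cos s - s * sin s) \<le> 0"
proof -
  have s1: "\<bar>s\<bar> \<le> 1" and "\<bar>c\<bar> \<le> 1"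
    using sum_squares_eq_1_imp_abs_le[OF cs] by simp_all
  then have c: "0 \<le> 1 + c" by simp
  have cos0: "0 \<le> cos s"
    using s1 pi_gt3 by (intro cos_ge_zero) auto
  \<comment> \<open>Expanded with \<open>s\<^sup>2 = 1 - c\<^sup>2\<close>, this becomes
    \<open>1 + c \<le> s\<^sup>2\<close>, which trades \<open>c\<close> for \<open>s\<close> in both
    coefficients.\<close>
  have "0 \<le> (1 + c) * (-c)"
    using c \<open>c \<le> 0\<close> by (intro mult_nonneg_nonneg) auto
  then have cs2: "1 + c \<le> s\<^sup>2"
    using cs by (simp add: power2_eq_square algebra_simps)
  have "cos (2 * s) \<le> (1 - s\<^sup>2) * cos s"
    by (rule cos_double_le[OF s1])
  also have "\<dots> \<le> exp (- (1 + c)) * cos s"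
    using cs2 exp_ge_add_one_self[of "- (1 + c)"] cos0 by (intro mult_right_mono) auto
  finally have "exp c * cos (2 * s) \<le> exp c * (exp (- (1 + c)) * cos s)"
    by (intro mult_left_mono) auto
  also have "\<dots> = exp (-1) * cos s"
    by (simp flip: mult.assoc exp_add)
  finally have "\<alpha> * (exp c * cos (2 * s) - cos s) \<le> \<alpha> * ((exp (-1) - 1) * cos s)"
    using \<open>0 \<le> \<alpha>\<close> by (intro mult_left_mono) (auto simp: algebra_simps)
  moreover have "(1 + c) * cos s \<le> s\<^sup>2 * cos s"
    using cs2 cos0 by (rule mult_right_mono)
  then have "k * (c * cos s - s * sin s) \<le> k * (- cos s)"
    using x_sin_ge(2)[OF s1] \<open>0 \<le> k\<close> by (intro mult_left_mono) (auto simp: algebra_simps)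
  moreover have "0 \<le> (\<alpha> * (1 - exp (-1)) + k - 1) * cos s"
    using bd cos0 by (intro mult_nonneg_nonneg) auto
  ultimately show ?thesis by (simp add: algebra_simps)
qed

text \<open>The right side is \<open>Re ((exp \<zeta> - 1) * cnj \<zeta>)\<close> for
  \<open>\<zeta> = c + i s\<close>, the factor of \<open>\<alpha>\<close> in the next bound. With
  \<open>?X\<close> at least 5/6 and \<open>exp c \<ge> 1 + c\<close> it is at least
  \<open>5/6 - c/6\<close>. The constant 2/3 suffices because e is at most 3, so
  \<open>1 - exp (-1) \<le> 2/3\<close>.\<close>

lemma unit_circle_exp_bound:
  fixes c s :: real
  assumes cs: "c\<^sup>2 + s\<^sup>2 = 1" and "0 \<le> c"
  shows "2 / 3 \<le> exp c * (c * cos s + s * sin s) - c"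
proof -
  have s1: "\<bar>s\<bar> \<le> 1" and "\<bar>c\<bar> \<le> 1"
    using sum_squares_eq_1_imp_abs_le[OF cs] by simp_all
  then have c1: "c \<le> 1" by simp
  let ?X = "c * cos s + s * sin s"
  have s2: "s\<^sup>2 = 1 - c\<^sup>2" using cs by simp
  have "c * (1 - s\<^sup>2 / 2) + (s\<^sup>2 - s ^ 4 / 6) \<le> ?X"
    using x_sin_ge(1)[OF s1] cos_ge_quadratic[of s] \<open>0 \<le> c\<close> by (intro add_mono mult_left_mono)
  moreover have "s ^ 4 = (s\<^sup>2)\<^sup>2" by simp
  ultimately have "c * (1 - (1 - c\<^sup>2) / 2) + ((1 - c\<^sup>2) - (1 - c\<^sup>2)\<^sup>2 / 6) \<le> ?X"
    by (simp only: s2)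
  moreover have "5 / 6 \<le> c * (1 - (1 - c\<^sup>2) / 2) + ((1 - c\<^sup>2) - (1 - c\<^sup>2)\<^sup>2 / 6)"
  proof -
    \<comment> \<open>The polynomial equals 5/6 at \<open>c = 0\<close>, so \<open>c\<close> splits
      off; the cofactor is written as a sum of terms nonnegative on [0,1].\<close>
    have "c * (1 - (1 - c\<^sup>2) / 2) + ((1 - c\<^sup>2) - (1 - c\<^sup>2)\<^sup>2 / 6) - 5 / 6
        = c * ((c - 1)\<^sup>2 / 3 + 1 / 6 + c\<^sup>2 * (1 - c) / 6)"
      by (simp add: field_simps power2_eq_square)
    also have "\<dots> \<ge> 0"
      using \<open>0 \<le> c\<close> c1 by (intro mult_nonneg_nonneg add_nonneg_nonneg) auto
    finally show ?thesis by simp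
  qed
  ultimately have X: "5 / 6 \<le> ?X" by linarith
  have "5 / 6 * (1 + c) \<le> ?X * exp c"
    using X \<open>0 \<le> c\<close> by (intro mult_mono) auto
  then show ?thesis using c1 by (simp add: algebra_simps)
qed

text \<open>The right side is the component of \<open>(A - 1) * exp (-\<zeta>)\<close> along
  \<open>\<zeta>\<close>. The terms in \<open>\<alpha>\<close> and \<open>k\<close> contribute at
  least 1 by \<open>bd\<close>, and the resulting \<open>1 + c\<close> dominates both terms carrying
  \<open>exp (-c)\<close>.\<close>

lemma unit_circle_bound_right:
  fixes c s \<alpha> k :: real
  assumes cs: "c\<^sup>2 + s\<^sup>2 = 1" and "0 \<le> c"
    and "0 \<le> \<alpha>" and bd: "\<alpha> * (1 - exp (-1)) + k \<ge> 1"
  shows "exp (-c) \<le> c + \<alpha> * (exp c * (c * cos s + s * sin s) - c) + k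
                     - exp (-c) * (c * cos s - s * sin s)"
proof -
  have s1: "\<bar>s\<bar> \<le> 1"
    using sum_squares_eq_1_imp_abs_le[OF cs] by simp
  have "1 / 3 \<le> exp (-1 :: real)"
    using exp_le by (simp add: exp_minus field_simps)
  then have "\<alpha> * (1 - exp (-1)) \<le> \<alpha> * (exp c * (c * cos s + s * sin s) - c)"
    using unit_circle_exp_bound[OF assms(1,2)] \<open>0 \<le> \<alpha>\<close> by (intro mult_left_mono) auto
  moreover have "exp (-c) * (1 + (c * cos s - s * sin s)) \<le> 1 * (1 + c)"
  proof -
    have "1 + (c * cos s - s * sin s) \<le> 1 + c"
      using x_sin_ge(3)[OF s1] mult_left_mono[OF cos_le_one \<open>0 \<le> c\<close>, of s] by simp
    then have "exp (-c) * (1 + (c * cos s - s * sin s)) \<le> exp (-c) * (1 + c)"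
      by (intro mult_left_mono) auto
    also have "\<dots> \<le> 1 * (1 + c)"
      using \<open>0 \<le> c\<close> by (intro mult_right_mono) auto
    finally show ?thesis .
  qed
  ultimately show ?thesis using bd by (simp add: algebra_simps)
qed

lemma exp_admissible:
  fixes \<zeta> :: complex and \<alpha> k :: real
  assumes \<zeta>: "norm \<zeta> = 1" and "0 \<le> \<alpha>" "0 \<le> k" and bd: "\<alpha> * (1 - exp (-1)) + k \<ge> 1"
  shows "1 \<le> norm (exp \<zeta> * (1 - \<alpha> + \<alpha> * exp \<zeta> + k * \<zeta>) - 1)" (is "1 \<le> norm (?A - 1)")
proof -
  define c s where "c = Re \<zeta>" and "s = Im \<zeta>"
  have cs: "c\<^sup>2 + s\<^sup>2 = 1"
    using \<zeta> by (simp add: c_def s_def flip: cmod_power2)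
  show ?thesis
  proof (cases "c \<le> 0")
    case True
    have "Re ?A = exp c * (cos s + \<alpha> * (exp c * cos (2 * s) - cos s)
                            + k * (c * cos s - s * sin s))"
      unfolding cos_double by (simp add: Re_exp Im_exp c_def s_def algebra_simps power2_eq_square)
    also have "\<dots> \<le> 0"
      using unit_circle_bound_left[OF cs True \<open>0 \<le> \<alpha>\<close> \<open>0 \<le> k\<close> bd]
      by (simp add: mult_nonneg_nonpos)
    finally show ?thesis
      using abs_Re_le_cmod[of "?A - 1"] by simp
  next
    case False
    let ?B = "1 - \<alpha> + \<alpha> * exp \<zeta> + k * \<zeta> - exp (- \<zeta>)"
    have "?A - 1 = exp \<zeta> * ?B"
      by (simp add: algebra_simps flip: exp_add)
    \<comment> \<open>Multiplying by \<open>cnj \<zeta>\<close> keeps the norm and turns the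
      component along \<open>\<zeta>\<close> into a real part, where \<open>k\<close> appears with
      factor \<open>c\<^sup>2 + s\<^sup>2 = 1\<close>.\<close>
    then have norm_eq: "norm (?A - 1) = exp c * norm (?B * cnj \<zeta>)"
      by (simp add: norm_mult \<zeta> c_def)
    have "Re (?B * cnj \<zeta>) = c + \<alpha> * (exp c * (c * cos s + s * sin s) - c) + k * (c\<^sup>2 + s\<^sup>2)
                     - exp (-c) * (c * cos s - s * sin s)"
      by (simp add: Re_exp Im_exp c_def s_def algebra_simps power2_eq_square)
    then have "exp (-c) \<le> Re (?B * cnj \<zeta>)"
      using unit_circle_bound_right[OF cs _ \<open>0 \<le> \<alpha>\<close> bd] False by (simp add: cs)
    then have "exp (-c) \<le> norm (?B * cnj \<zeta>)"
      using complex_Re_le_cmod order_trans by blast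
    then have "exp c * exp (-c) \<le> exp c * norm (?B * cnj \<zeta>)"
      by (intro mult_left_mono) auto
    then show ?thesis unfolding norm_eq by (simp flip: exp_add)
  qed
qed

section \<open>Jack's lemma from one-sided derivatives\<close>

text \<open>Along the segment leaving \<open>z\<^sub>0\<close> in direction
  \<open>- z\<^sub>0 * c\<close>, the real part of \<open>cnj (f z\<^sub>0) * f\<close> starts at 1
  and stays below \<open>1 - \<mu> * t\<close>; comparing slopes at \<open>t = 0\<close> gives the
  bound.\<close>

lemma boundary_derivative_ge:
  fixes f :: "complex \<Rightarrow> complex" and z\<^sub>0 f' c :: complex and \<mu> d :: real
  assumes f': "(f has_field_derivative f') (at z\<^sub>0)" and "norm (f z\<^sub>0) = 1" and "0 < d"
    and bd: "\<And>t. 0 < t \<Longrightarrow> t < d \<Longrightarrow> norm (f (z\<^sub>0 * (1 - t * c))) \<le> 1 - \<mu> * t"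
  shows "\<mu> \<le> Re (c * (cnj (f z\<^sub>0) * (z\<^sub>0 * f')))"
proof (rule ccontr)
  assume neg: "\<not> ?thesis"
  \<comment> \<open>The gap \<open>g\<close> vanishes at 0 and is nonnegative just to the right, but
    failure of the claim would make its derivative at 0 negative.\<close>
  define g where "g t = 1 - \<mu> * t - Re (cnj (f z\<^sub>0) * f (z\<^sub>0 * (1 - of_real t * c)))" for t
  have "((\<lambda>t. z\<^sub>0 * (1 - of_real t * c)) has_vector_derivative - (z\<^sub>0 * c)) (at 0)"
    by (auto intro!: derivative_eq_intros simp: has_vector_derivative_def scaleR_conv_of_real)
  then have "((\<lambda>t. f (z\<^sub>0 * (1 - of_real t * c))) has_vector_derivative - (z\<^sub>0 * c) * f') (at 0)"
    using field_vector_diff_chain_at[of "\<lambda>t. z\<^sub>0 * (1 - of_real t * c)" "- (z\<^sub>0 * c)" 0 f f'] f'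
    by (simp add: o_def)
  from bounded_linear.has_vector_derivative[OF
      bounded_linear_compose[OF bounded_linear_Re bounded_linear_mult_right] this]
  have "((\<lambda>t. Re (cnj (f z\<^sub>0) * f (z\<^sub>0 * (1 - of_real t * c)))) has_real_derivative
      Re (cnj (f z\<^sub>0) * (- (z\<^sub>0 * c) * f'))) (at 0)"
    unfolding has_real_derivative_iff_has_vector_derivative .
  then have "(g has_real_derivative 0 - \<mu> - Re (cnj (f z\<^sub>0) * (- (z\<^sub>0 * c) * f'))) (at 0)"
    unfolding g_def by (rule DERIV_diff[OF DERIV_diff[OF DERIV_const DERIV_cmult_Id]])
  moreover have "0 - \<mu> - Re (cnj (f z\<^sub>0) * (- (z\<^sub>0 * c) * f'))
      = Re (c * (cnj (f z\<^sub>0) * (z\<^sub>0 * f'))) - \<mu>"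
    by (simp add: algebra_simps)
  ultimately have "\<exists>e>0. \<forall>h>0. h < e \<longrightarrow> g (0 + h) < g 0"
    using neg by (intro DERIV_neg_dec_right) auto
  then obtain e where e: "0 < e" "\<And>h. 0 < h \<Longrightarrow> h < e \<Longrightarrow> g h < g 0" by auto
  have "Re (cnj (f z\<^sub>0) * f z\<^sub>0) = 1"
    using \<open>norm (f z\<^sub>0) = 1\<close> by (simp add: mult.commute complex_mult_cnj flip: cmod_power2)
  then have g0: "g 0 = 0" by (simp add: g_def)
  define t where "t = min d e / 2"
  have t: "0 < t" "t < d" "t < e" using \<open>0 < d\<close> e by (auto simp: t_def)
  have "Re (cnj (f z\<^sub>0) * f (z\<^sub>0 * (1 - t * c))) \<le> norm (cnj (f z\<^sub>0) * f (z\<^sub>0 * (1 - t * c)))"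
    by (rule complex_Re_le_cmod)
  also have "\<dots> \<le> 1 - \<mu> * t"
    using bd[OF t(1,2)] \<open>norm (f z\<^sub>0) = 1\<close> by (simp add: norm_mult)
  finally show False using e(2)[OF t(1,3)] by (simp add: g0) (simp add: g_def)
qed

text \<open>As \<open>f z\<^sub>0\<close> has modulus 1, \<open>M\<close> is the quotient of
  \<open>z\<^sub>0 * f'\<close> by \<open>f z\<^sub>0\<close>. The radial direction and the Schwarz
  lemma give \<open>Re M \<ge> 1\<close>; all other inward directions together force
  \<open>M\<close> to be real.\<close>

lemma Jack_lemma:
  fixes f :: "complex \<Rightarrow> complex"
  assumes holf: "f holomorphic_on ball 0 (norm z\<^sub>0)" and f0: "f 0 = 0" and "z\<^sub>0 \<noteq> 0"
    and less: "\<And>z. norm z < norm z\<^sub>0 \<Longrightarrow> norm (f z) < 1" and one: "norm (f z\<^sub>0) = 1"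
    and f': "(f has_field_derivative f') (at z\<^sub>0)"
  obtains m :: real where "1 \<le> m" "z\<^sub>0 * f' = m * f z\<^sub>0"
proof -
  define r where "r = norm z\<^sub>0"
  have "0 < r" using \<open>z\<^sub>0 \<noteq> 0\<close> by (simp add: r_def)
  define M where "M = cnj (f z\<^sub>0) * (z\<^sub>0 * f')"
  have "1 \<le> Re (1 * M)"
    unfolding M_def
  proof (rule boundary_derivative_ge[OF f' one zero_less_one])
    fix t :: real assume t: "0 < t" "t < 1"
    have norm_t: "norm (1 - complex_of_real t) = 1 - t"
      using norm_of_real[of "1 - t", where 'a = complex] t by simp
    have "norm ((\<lambda>z. f (z\<^sub>0 * z)) (1 - complex_of_real t)) \<le> norm (1 - complex_of_real t)"
    proof (rule Schwarz_Lemma(1))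
      show "(\<lambda>z. f (z\<^sub>0 * z)) holomorphic_on ball 0 1"
        using \<open>0 < r\<close> by (intro holomorphic_on_compose_gen[OF _ holf, unfolded o_def] holomorphic_intros)
          (auto simp: norm_mult r_def)
      show "norm (f (z\<^sub>0 * z)) < 1" if "norm z < 1" for z
        using that \<open>0 < r\<close> by (intro less) (simp add: norm_mult r_def)
      show "norm (1 - complex_of_real t) < 1"
        using t norm_t by simp
    qed (use f0 in auto)
    also have "\<dots> = 1 - 1 * t"
      using norm_t by simp
    finally show "norm (f (z\<^sub>0 * (1 - complex_of_real t * 1))) \<le> 1 - 1 * t" by simp
  qed
  then have ReM: "1 \<le> Re M" by simp
  have half_plane: "0 \<le> Re (c * M)" if "0 < Re c" for c
    unfolding M_def
  proof (rule boundary_derivative_ge[OF f' one])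
    have "c \<noteq> 0" using that by auto
    \<comment> \<open>This is the chord length: for positive \<open>t\<close>,
      \<open>norm (1 - t * c) < 1\<close> holds exactly while \<open>t\<close> is below it.\<close>
    then show "0 < 2 * Re c / (norm c)\<^sup>2" using that by simp
    fix t :: real assume t: "0 < t" "t < 2 * Re c / (norm c)\<^sup>2"
    have "t * (t * (norm c)\<^sup>2) < t * (2 * Re c)"
      using t \<open>c \<noteq> 0\<close> by (intro mult_strict_left_mono) (auto simp: field_simps)
    moreover have "(norm (1 - t * c))\<^sup>2 = 1 - t * (2 * Re c) + t * (t * (norm c)\<^sup>2)"
      unfolding cmod_power2 by (simp add: power2_eq_square algebra_simps)
    ultimately have "(norm (1 - t * c))\<^sup>2 < 1\<^sup>2" by simp
    then have "norm (1 - t * c) < 1"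
      using power2_less_imp_less zero_le_one by blast
    then have "norm (f (z\<^sub>0 * (1 - t * c))) < 1"
      using \<open>0 < r\<close> by (intro less) (simp add: norm_mult r_def)
    then show "norm (f (z\<^sub>0 * (1 - t * c))) \<le> 1 - 0 * t" by simp
  qed
  have "Im M = 0"
  proof (rule ccontr)
    assume *: "Im M \<noteq> 0"
    \<comment> \<open>This direction is tilted so that the product has real part
      \<open>(Im M)\<^sup>2 / 2 - (Im M)\<^sup>2\<close>, which is negative.\<close>
    have "0 \<le> Re (Complex ((Im M)\<^sup>2 / (2 * Re M)) (Im M) * M)"
      using * ReM by (intro half_plane) (simp add: zero_less_divide_iff)
    also have "\<dots> = - (Im M)\<^sup>2 / 2"
      using ReM by (simp add: field_simps power2_eq_square)
    finally show False using * by simp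
  qed
  then have "M = Re M" by (simp add: complex_eq_iff)
  have "f z\<^sub>0 * cnj (f z\<^sub>0) = 1"
    by (simp add: one flip: complex_norm_square)
  then have "z\<^sub>0 * f' = M * f z\<^sub>0" by (simp add: M_def algebra_simps)
  with \<open>M = Re M\<close> ReM show thesis by (metis that)
qed

section \<open>Subordination to exp and the first exit point\<close>

lemma exp_cball_notin_nonpos_Reals:
  assumes "norm z \<le> 1"
  shows "exp z \<notin> \<real>\<^sub>\<le>\<^sub>0" and "Ln (exp z) = z"
proof -
  have "\<bar>Im z\<bar> \<le> 1" using abs_Im_le_cmod[of z] assms by simp
  then have "0 < cos (Im z)" using pi_gt3 by (intro cos_gt_zero_pi) auto
  then have "0 < Re (exp z)" by (simp add: Re_exp)
  then show "exp z \<notin> \<real>\<^sub>\<le>\<^sub>0" by (auto simp: complex_nonpos_Reals_iff)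
  show "Ln (exp z) = z" using \<open>\<bar>Im z\<bar> \<le> 1\<close> pi_gt3 by (intro Ln_exp) auto
qed

text \<open>The Schwarz function is \<open>Ln (p z)\<close>: the image of the disc under exp avoids
  the branch cut, and there \<open>Ln\<close> inverts exp.\<close>

lemma subordinate_expI:
  assumes "p holomorphic_on ball 0 1" "p 0 = 1" and "p ` ball 0 1 \<subseteq> exp ` ball 0 1"
  shows "p \<prec>\<^sub>s (\<lambda>z. exp z)"
  unfolding subordinate_def
proof (intro conjI exI[of _ "\<lambda>z. Ln (p z)"] ballI)
  have ex: "\<exists>y. norm y < 1 \<and> p z = exp y" if "z \<in> ball 0 1" for z
  proof -
    have "p z \<in> exp ` ball 0 1" using assms(3) that by blast
    then show ?thesis by auto
  qed
  have "p z \<notin> \<real>\<^sub>\<le>\<^sub>0" if "z \<in> ball 0 1" for z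
    using ex[OF that] exp_cball_notin_nonpos_Reals(1) by (metis less_imp_le)
  then show "(\<lambda>z. Ln (p z)) holomorphic_on ball 0 1"
    using assms(1) by (intro holomorphic_intros) auto
  fix z :: complex assume "z \<in> ball 0 1"
  then obtain y where "norm y < 1" "p z = exp y" using ex by blast
  then show "norm (Ln (p z)) < 1" "p z = exp (Ln (p z))"
    by (simp_all add: exp_cball_notin_nonpos_Reals(2))
qed (use assms in \<open>auto intro!: holomorphic_intros\<close>)

lemma first_exit_point:
  fixes p :: "complex \<Rightarrow> complex"
  assumes contp: "continuous_on (ball 0 1) p" and "open U" and nsub: "\<not> p ` ball 0 1 \<subseteq> U"
  obtains z\<^sub>0 where "norm z\<^sub>0 < 1" "p z\<^sub>0 \<notin> U" "\<And>z. norm z < norm z\<^sub>0 \<Longrightarrow> p z \<in> U"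
proof -
  from nsub obtain a where "a \<in> ball 0 1" and a: "p a \<notin> U" by blast
  then have "norm a < 1" by simp
  have sub: "cball 0 (norm a) \<subseteq> ball (0::complex) 1" using \<open>norm a < 1\<close> by auto
  \<comment> \<open>Cutting at the modulus of one bad point \<open>a\<close> makes the set of bad
    points compact, so a least modulus is attained; points outside the cut are farther out
    anyway.\<close>
  define S where "S = cball 0 (norm a) \<inter> p -` (- U)"
  have "closed S"
    unfolding S_def using contp sub \<open>open U\<close>
    by (intro continuous_closed_preimage) (auto intro: continuous_on_subset)
  then have "compact S"
    unfolding S_def by (metis Int_lower1 bounded_cball bounded_subset compact_eq_bounded_closed)
  moreover have "a \<in> S" using a by (simp add: S_def)
  ultimately obtain z\<^sub>0 where z0: "z\<^sub>0 \<in> S" "\<And>z. z \<in> S \<Longrightarrow> norm z\<^sub>0 \<le> norm z"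
    using continuous_attains_inf[of S norm] by (metis continuous_on_norm_id empty_iff)
  show thesis
  proof
    show "norm z\<^sub>0 < 1" "p z\<^sub>0 \<notin> U" using z0(1) sub by (auto simp: S_def)
    show "p z \<in> U" if "norm z < norm z\<^sub>0" for z
      using z0(2)[of z] z0(1) that by (force simp: S_def)
  qed
qed

text \<open>The Miller--Mocanu boundary lemma for the dominant \<open>exp\<close>.\<close>

lemma not_subordinate_exp_boundary_point:
  assumes holp: "p holomorphic_on ball 0 1" and p0: "p 0 = 1" and nsub: "\<not> p \<prec>\<^sub>s (\<lambda>z. exp z)"
  obtains z\<^sub>0 \<zeta> :: complex and m :: real
    where "norm z\<^sub>0 < 1" "norm \<zeta> = 1" "1 \<le> m" "p z\<^sub>0 = exp \<zeta>"
      "z\<^sub>0 * deriv p z\<^sub>0 = m * \<zeta> * exp \<zeta>"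
proof -
  let ?U = "exp ` ball (0::complex) 1"
  have inj: "inj_on exp (ball (0::complex) 1)"
    by (rule inj_on_inverseI[of _ Ln]) (simp add: exp_cball_notin_nonpos_Reals(2))
  have "open ?U"
    by (rule open_mapping_thm3[OF _ _ inj]) (auto intro!: holomorphic_intros)
  have "\<not> p ` ball 0 1 \<subseteq> ?U" using subordinate_expI[OF holp p0] nsub by blast
  then obtain z\<^sub>0 where z0: "norm z\<^sub>0 < 1" "p z\<^sub>0 \<notin> ?U"
      and inside: "\<And>z. norm z < norm z\<^sub>0 \<Longrightarrow> p z \<in> ?U"
    using first_exit_point holomorphic_on_imp_continuous_on[OF holp] \<open>open ?U\<close> by metis
  have "z\<^sub>0 \<noteq> 0"
  proof
    assume "z\<^sub>0 = 0"
    then have "p z\<^sub>0 = exp 0" using p0 by simp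
    then show False using z0(2) by (metis centre_in_ball imageI zero_less_one)
  qed
  \<comment> \<open>As a limit of values in \<open>?U\<close>, \<open>p z\<^sub>0\<close> lies in
    exp of the closed disc; being outside \<open>?U\<close>, it must come from the unit
    circle.\<close>
  have "p z\<^sub>0 \<in> closure (p ` ball 0 (norm z\<^sub>0))"
  proof -
    have "closure (ball (0::complex) (norm z\<^sub>0)) = cball 0 (norm z\<^sub>0)"
      using \<open>z\<^sub>0 \<noteq> 0\<close> by simp
    moreover have "continuous_on (cball 0 (norm z\<^sub>0)) p"
      using z0(1) by (intro holomorphic_on_imp_continuous_on holomorphic_on_subset[OF holp]) auto
    ultimately have "p ` cball 0 (norm z\<^sub>0) \<subseteq> closure (p ` ball 0 (norm z\<^sub>0))"
      by (metis closed_closure closure_subset image_closure_subset)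
    then show ?thesis by auto
  qed
  also have "closure (p ` ball 0 (norm z\<^sub>0)) \<subseteq> exp ` cball 0 1"
  proof (rule closure_minimal)
    show "p ` ball 0 (norm z\<^sub>0) \<subseteq> exp ` cball 0 1" using inside by force
    show "closed (exp ` cball (0::complex) 1)"
      by (intro compact_imp_closed compact_continuous_image continuous_intros compact_cball)
  qed
  finally obtain \<zeta> where \<zeta>: "norm \<zeta> \<le> 1" "p z\<^sub>0 = exp \<zeta>" by auto
  then have "norm \<zeta> = 1" using z0(2) by force
  define w where "w z = Ln (p z)" for z
  have w: "norm (w z) < 1" "p z \<notin> \<real>\<^sub>\<le>\<^sub>0" if "norm z < norm z\<^sub>0" for z
    using inside[OF that] exp_cball_notin_nonpos_Reals by (auto simp: w_def)
  have wz0: "w z\<^sub>0 = \<zeta>" using \<zeta> by (simp add: w_def exp_cball_notin_nonpos_Reals(2))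
  have dp: "(p has_field_derivative deriv p z\<^sub>0) (at z\<^sub>0)"
    using holp z0(1) by (intro holomorphic_derivI[OF holp]) auto
  \<comment> \<open>\<open>Ln\<close> is differentiable at \<open>p z\<^sub>0\<close> because exp of
    the closed disc also avoids the branch cut.\<close>
  have "(w has_field_derivative deriv p z\<^sub>0 / p z\<^sub>0) (at z\<^sub>0)"
    unfolding w_def using dp exp_cball_notin_nonpos_Reals(1)[OF \<zeta>(1)] \<zeta>(2)
    by (auto intro!: derivative_eq_intros simp: field_simps)
  moreover have "w holomorphic_on ball 0 (norm z\<^sub>0)"
    unfolding w_def using w(2) z0(1)
    by (intro holomorphic_on_Ln' holomorphic_on_subset[OF holp]) auto
  ultimately obtain m :: real where m: "1 \<le> m" "z\<^sub>0 * (deriv p z\<^sub>0 / p z\<^sub>0) = m * w z\<^sub>0"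
    using \<open>z\<^sub>0 \<noteq> 0\<close> w(1) wz0 \<open>norm \<zeta> = 1\<close> p0
    by (elim Jack_lemma) (auto simp: w_def)
  have "z\<^sub>0 * deriv p z\<^sub>0 = m * \<zeta> * exp \<zeta>"
    using m(2) by (simp add: wz0 \<zeta>(2) field_simps)
  then show thesis using that z0(1) \<open>norm \<zeta> = 1\<close> m(1) \<zeta>(2) by blast
qed

theorem theorem3p5:
  fixes \<alpha> \<beta> :: real and p :: "complex \<Rightarrow> complex"
  assumes "\<alpha> > 0" and "\<beta> > 0"
    and "\<alpha> * (exp 1 - 1) + \<beta> * exp 1 \<ge> exp 1"
    and "p \<in> class_H1"
    and "(\<lambda>z. (1 - of_real \<alpha>) * p z + of_real \<alpha> * (p z)\<^sup>2 + of_real \<beta> * z * deriv p z)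
           \<prec>\<^sub>s (\<lambda>z. 1 + z)"
  shows "p \<prec>\<^sub>s (\<lambda>z. exp z)"
proof (rule ccontr)
  assume nsub: "\<not> ?thesis"
  have "p holomorphic_on ball 0 1" "p 0 = 1"
    using assms(4) by (auto simp: class_H1_def)
  from not_subordinate_exp_boundary_point[OF this nsub]
  obtain z\<^sub>0 \<zeta> :: complex and m :: real
    where z0: "norm z\<^sub>0 < 1" and "norm \<zeta> = 1" "1 \<le> m"
      and p: "p z\<^sub>0 = exp \<zeta>" "z\<^sub>0 * deriv p z\<^sub>0 = m * \<zeta> * exp \<zeta>" .
  \<comment> \<open>Dividing the hypothesis by e gives the admissibility condition for
    \<open>k = \<beta>\<close>; passing to \<open>k = \<beta> * m\<close> only strengthens
    it.\<close>
  have "exp (-1) * exp 1 \<le> exp (-1) * (\<alpha> * (exp 1 - 1) + \<beta> * exp 1)"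
    using assms(3) by (intro mult_left_mono) auto
  also have "\<dots> = \<alpha> * (1 - exp (-1)) + \<beta>"
    by (simp add: exp_minus field_simps)
  also have "\<dots> \<le> \<alpha> * (1 - exp (-1)) + \<beta> * m"
    using mult_left_mono[OF \<open>1 \<le> m\<close>, of \<beta>] \<open>\<beta> > 0\<close> by simp
  finally have "1 \<le> \<alpha> * (1 - exp (-1)) + \<beta> * m"
    by (simp flip: exp_add)
  then have ge: "1 \<le> norm (exp \<zeta> * (1 - \<alpha> + \<alpha> * exp \<zeta> + (\<beta> * m) * \<zeta>) - 1)"
    using exp_admissible[OF \<open>norm \<zeta> = 1\<close>, of \<alpha> "\<beta> * m"] assms(1,2) \<open>1 \<le> m\<close> by simp
  obtain w where w: "\<And>z. z \<in> ball 0 1 \<Longrightarrow> norm (w z) < 1 \<and>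
      (1 - of_real \<alpha>) * p z + of_real \<alpha> * (p z)\<^sup>2 + of_real \<beta> * z * deriv p z = 1 + w z"
    using assms(5) unfolding subordinate_def by blast
  have "exp \<zeta> * (1 - \<alpha> + \<alpha> * exp \<zeta> + (\<beta> * m) * \<zeta>)
      = (1 - \<alpha>) * p z\<^sub>0 + \<alpha> * (p z\<^sub>0)\<^sup>2 + \<beta> * (z\<^sub>0 * deriv p z\<^sub>0)"
    unfolding p by (simp add: algebra_simps power2_eq_square)
  also have "\<dots> = 1 + w z\<^sub>0"
    using w[of z\<^sub>0] z0 by (simp add: mult.assoc)
  finally have "exp \<zeta> * (1 - \<alpha> + \<alpha> * exp \<zeta> + (\<beta> * m) * \<zeta>) - 1 = w z\<^sub>0"
    by simp
  then show False using ge w[of z\<^sub>0] z0 by simp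
qed

end
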